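(* Let $\mathcal{P}=(V;\leq_{\mathcal{P}})$ be a finite poset and let $\varphi:\mathcal{I}(\mathcal{P})\to\mathcal{I}(\mathcal{P})$ be an idempotent Steiner operation ($\varphi\circ\varphi=\varphi$). Then there exists a unique partial order $\leq_{\mathcal{Q}}$ on $V$ with $\leq_{\mathcal{P}}\subseteq\leq_{\mathcal{Q}}$ (as subsets of $V\times V$) such that, writing $\mathcal{Q}=(V;\leq_{\mathcal{Q}})$, \[ \mathrm{Range}(\varphi)=\mathcal{I}(\mathcal{Q}). \]
   Context: For a finite poset $\mathcal{P}=(V;\leq)$, a set $I\subseteq V$ is an (order) ideal if $y\in I$ and $x\leq y$ imply $x\in I$; $\mathcal{I}(\mathcal{P})$ denotes the set of all ideals of $\mathcal{P}$. Let $n=|V|$. A Steiner operation (StOp) is a map $\varphi:\mathcal{I}(\mathcal{P})\to\mathcal{I}(\mathcal{P})$, together with a boundary functional $\partial:2^V\to\mathbb{R}$, satisfying: (1) $|\varphi(S)|=|S|$ for all $S\in\mathcal{I}(\mathcal{P})$; (2) $\partial(\varphi(S))\leq\partial(S)$ for all $S\in\mathcal{I}(\mathcal{P})$; (3) $S\subseteq T$ implies $\varphi(S)\subseteq\varphi(T)$; (4) there is a bijection $\tau:V\to\{0,1,\dots,n-1\}$ with $x\leq y\Rightarrow\tau(x)\leq\tau(y)$ such that, writing $\tau(S)=\sum_{x\in S}\tau(x)$, for all $S\in\mathcal{I}(\mathcal{P})$ one has $\tau(\varphi(S))\leq\tau(S)$, and $\tau(\varphi(S))=\tau(S)$ implies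 $\varphi(S)=S$. $\mathrm{Range}(\varphi)=\{T\in\mathcal{I}(\mathcal{P}):\exists S\in\mathcal{I}(\mathcal{P}),\ \varphi(S)=T\}$. (The order $\mathcal{Q}$ in the conclusion is called the StOp-order of $\varphi$.) *)

theory Defs
  imports Complex_Main "HOL-Library.FuncSet"
begin

definition order_ideals :: "'a set \<Rightarrow> 'a rel \<Rightarrow> 'a set set" where
  "order_ideals V r = {I. I \<subseteq> V \<and> (\<forall>y\<in>I. \<forall>x\<in>V. (x, y) \<in> r \<longrightarrow> x \<in> I)}"

(* Only the values of \<phi> on ideals and of bd on subsets of V are ever used. *)
definition steiner_operation ::
  "'a set \<Rightarrow> 'a rel \<Rightarrow> ('a set \<Rightarrow> real) \<Rightarrow> ('a set \<Rightarrow> 'a set) \<Rightarrow> bool" where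
  "steiner_operation V r bd \<phi> \<longleftrightarrow>
     \<phi> \<in> order_ideals V r \<rightarrow> order_ideals V r \<and>
     (\<forall>S\<in>order_ideals V r. card (\<phi> S) = card S) \<and>
     (\<forall>S\<in>order_ideals V r. bd (\<phi> S) \<le> bd S) \<and>
     (\<forall>S\<in>order_ideals V r. \<forall>T\<in>order_ideals V r. S \<subseteq> T \<longrightarrow> \<phi> S \<subseteq> \<phi> T) \<and>
     (\<exists>\<tau> :: 'a \<Rightarrow> nat.
        bij_betw \<tau> V {0..<card V} \<and>
        (\<forall>x\<in>V. \<forall>y\<in>V. (x, y) \<in> r \<longrightarrow> \<tau> x \<le> \<tau> y) \<and>
        (\<forall>S\<in>order_ideals V r.
           sum \<tau> (\<phi> S) \<le> sum \<tau> S \<and>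
           (sum \<tau> (\<phi> S) = sum \<tau> S \<longrightarrow> \<phi> S = S)))"

definition stop_range :: "'a set \<Rightarrow> 'a rel \<Rightarrow> ('a set \<Rightarrow> 'a set) \<Rightarrow> 'a set set" where
  "stop_range V r \<phi> = {T \<in> order_ideals V r. \<exists>S\<in>order_ideals V r. \<phi> S = T}"

end

theory Submission
  imports Defs
begin

text \<open>
  Since \<open>\<phi>\<close> is monotone and preserves cardinality, its fixed ideals, which by idempotence form
  its range, are closed under unions and intersections and include \<open>{}\<close> and \<open>V\<close>; hence
  they are the ideals of the preorder ``every fixed ideal containing \<open>y\<close> contains \<open>x\<close>''.
  This preorder is antisymmetric because \<open>\<phi>\<close> maps the chain of initial segments of \<open>\<tau>\<close>
  to a chain of fixed ideals with one member of each size, and such a chain separates points.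
  Uniqueness holds because a partial order is determined by its ideals.
\<close>

text \<open>The principal ideal of \<open>y\<close> decides the matter: transitivity makes it an
  ideal, reflexivity puts \<open>y\<close> into it, and its members are exactly the elements below
  \<open>y\<close>. This recovers the order from its ideals and yields uniqueness.\<close>

lemma partial_order_eq_ideal_membership:
  assumes "partial_order_on V Q"
  shows "Q = {(x, y) \<in> V \<times> V. \<forall>T\<in>order_ideals V Q. y \<in> T \<longrightarrow> x \<in> T}"
proof (intro subset_antisym subrelI)
  fix x y assume "(x, y) \<in> Q"
  then show "(x, y) \<in> {(x, y) \<in> V \<times> V. \<forall>T\<in>order_ideals V Q. y \<in> T \<longrightarrow> x \<in> T}"
    using assms unfolding partial_order_on_def preorder_on_def order_ideals_def by blast
next
  fix x y assume xy: "(x, y) \<in> {(x, y) \<in> V \<times> V. \<forall>T\<in>order_ideals V Q. y \<in> T \<longrightarrow> x \<in> T}"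
  have down: "{z \<in> V. (z, y) \<in> Q} \<in> order_ideals V Q"
    using assms unfolding partial_order_on_def preorder_on_def order_ideals_def
    by (auto dest: transD)
  have "(y, y) \<in> Q"
    using assms xy unfolding partial_order_on_def preorder_on_def refl_on_def by auto
  then show "(x, y) \<in> Q" using xy bspec[OF _ down] by auto
qed

text \<open>Closure under intersection gives each point \<open>y\<close> a least member
  \<open>D y\<close> of \<open>L\<close> containing it, which is the set of points below
  \<open>y\<close>. An ideal is the union of the sets \<open>D y\<close> of its points, and closure
  under union puts it into \<open>L\<close>.\<close>

lemma finite_set_lattice_eq_order_ideals:
  assumes V: "finite V" and sub: "\<And>T. T \<in> L \<Longrightarrow> T \<subseteq> V"
    and bot: "{} \<in> L" and top: "V \<in> L"
    and int: "\<And>S T. S \<in> L \<Longrightarrow> T \<in> L \<Longrightarrow> S \<inter> T \<in> L"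
    and un: "\<And>S T. S \<in> L \<Longrightarrow> T \<in> L \<Longrightarrow> S \<union> T \<in> L"
  shows "L = order_ideals V {(x, y) \<in> V \<times> V. \<forall>T\<in>L. y \<in> T \<longrightarrow> x \<in> T}"
    (is "L = order_ideals V ?Q")
proof (intro subset_antisym subsetI)
  fix I assume "I \<in> L"
  then show "I \<in> order_ideals V ?Q" using sub by (auto simp: order_ideals_def)
next
  fix I assume I: "I \<in> order_ideals V ?Q"
  have fin: "finite L" using V sub by (auto intro: finite_subset[of L "Pow V"])
  \<comment> \<open>The family must be nonempty, since the empty intersection is
    \<open>UNIV\<close>; below, \<open>V\<close> itself is a member containing \<open>y\<close>. The
    empty union is covered by \<open>bot\<close>.\<close>
  have Int: "\<Inter>F \<in> L" if "finite F" "F \<noteq> {}" "F \<subseteq> L" for F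
    using that by (induction rule: finite_ne_induct) (auto intro: int)
  have Un: "\<Union>F \<in> L" if "finite F" "F \<subseteq> L" for F
    using that by (induction rule: finite_induct) (auto intro: un bot)
  define D where "D y = \<Inter>{T \<in> L. y \<in> T}" for y
  have IV: "I \<subseteq> V" using I by (auto simp: order_ideals_def)
  have D: "D y \<in> L" if "y \<in> I" for y
    unfolding D_def by (rule Int) (use fin top IV that in auto)
  have "D y \<subseteq> I" if "y \<in> I" for y
  proof
    fix x assume x: "x \<in> D y"
    have "y \<in> V" "x \<in> V" using x that IV top by (auto simp: D_def)
    moreover have "(x, y) \<in> ?Q" using x calculation by (auto simp: D_def)
    ultimately show "x \<in> I" using I that unfolding order_ideals_def by blast
  qed
  moreover have "y \<in> D y" for y by (auto simp: D_def)
  ultimately have "I = \<Union>(D ` I)" by blast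
  moreover have "\<Union>(D ` I) \<in> L"
    by (rule Un) (use D finite_subset[OF IV V] in auto)
  ultimately show "I \<in> L" by simp
qed

text \<open>Each step of the chain adds exactly one element. The step at which \<open>x\<close>
  enters therefore cannot also admit \<open>y\<close>, so one of its two ends separates
  them.\<close>

lemma full_chain_separates_points:
  fixes C :: "nat \<Rightarrow> 'a set"
  assumes mono: "\<And>i j. i \<le> j \<Longrightarrow> j \<le> n \<Longrightarrow> C i \<subseteq> C j"
    and fin: "finite (C n)" and card: "\<And>i. i \<le> n \<Longrightarrow> card (C i) = i"
    and x: "x \<in> C n" and "x \<noteq> y"
  obtains k where "k \<le> n" "(x \<in> C k) \<noteq> (y \<in> C k)"
proof -
  define k where "k = (LEAST k. x \<in> C k)"
  have xk: "x \<in> C k" and kn: "k \<le> n"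
    unfolding k_def using x by (auto intro: LeastI Least_le)
  have fink: "finite (C k)" using mono[OF kn order_refl] fin finite_subset by blast
  have "k \<noteq> 0" using card[OF kn] xk fink by (metis card_0_eq emptyE)
  then obtain m where m: "k = Suc m" using not0_implies_Suc by blast
  have xm: "x \<notin> C m" using not_less_Least[of m "\<lambda>k. x \<in> C k"] m by (simp add: k_def)
  have sub: "C m \<subseteq> C k" using mono[of m k] kn m by simp
  have "y \<notin> C k \<or> y \<in> C m"
  proof (rule ccontr)
    assume y: "\<not> (y \<notin> C k \<or> y \<in> C m)"
    then have "card (insert x (insert y (C m))) \<le> card (C k)"
      using sub xk by (intro card_mono fink) auto
    moreover have "finite (C m)" using finite_subset[OF sub fink] .
    ultimately show False using card[OF kn] card[of m] kn m xm y \<open>x \<noteq> y\<close> by simp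
  qed
  \<comment> \<open>If \<open>y\<close> is not yet in \<open>C k\<close>, then \<open>k\<close>
    separates; otherwise \<open>y\<close> is already in \<open>C m\<close> and \<open>m\<close>
    does.\<close>
  then show thesis using that[of k] that[of m] xk xm kn m by auto
qed

theorem theorem3:
  fixes V :: "'a set" and P :: "'a rel"
    and bd :: "'a set \<Rightarrow> real" and \<phi> :: "'a set \<Rightarrow> 'a set"
  assumes "finite V"
    and "partial_order_on V P"
    and "steiner_operation V P bd \<phi>"
    and "\<forall>S\<in>order_ideals V P. \<phi> (\<phi> S) = \<phi> S"
  shows "\<exists>!Q. partial_order_on V Q \<and> P \<subseteq> Q \<and> stop_range V P \<phi> = order_ideals V Q"
proof (rule ex_ex1I)
  define L where "L = stop_range V P \<phi>"
  define Q where "Q = {(x, y) \<in> V \<times> V. \<forall>T\<in>L. y \<in> T \<longrightarrow> x \<in> T}"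
  have map: "\<phi> S \<in> order_ideals V P" and card: "card (\<phi> S) = card S"
    if "S \<in> order_ideals V P" for S
    using assms(3) that unfolding steiner_operation_def by auto
  have mono: "\<phi> S \<subseteq> \<phi> T"
    if "S \<in> order_ideals V P" "T \<in> order_ideals V P" "S \<subseteq> T" for S T
    using assms(3) that unfolding steiner_operation_def by blast
  have fin: "finite S" if "S \<in> order_ideals V P" for S
    using that assms(1) finite_subset by (auto simp: order_ideals_def)
  \<comment> \<open>Idempotence turns the range into the set of fixed ideals.\<close>
  have L_iff: "T \<in> L \<longleftrightarrow> T \<in> order_ideals V P \<and> \<phi> T = T" for T
    unfolding L_def stop_range_def using assms(4) by auto
  have L_ideal: "T \<in> order_ideals V P" and L_fix: "\<phi> T = T" if "T \<in> L" for T
    using that L_iff by auto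
  have \<phi>L: "\<phi> S \<in> L" if "S \<in> order_ideals V P" for S
    using that map assms(4) L_iff by auto
  have bot: "{} \<in> L"
  proof -
    have "{} \<in> order_ideals V P" by (simp add: order_ideals_def)
    then show ?thesis using card fin map L_iff by (metis card.empty card_0_eq)
  qed
  have top: "V \<in> L"
  proof -
    have V: "V \<in> order_ideals V P" by (simp add: order_ideals_def)
    have "\<phi> V \<subseteq> V" using map[OF V] by (auto simp: order_ideals_def)
    then show ?thesis using card[OF V] V assms(1) L_iff by (simp add: card_subset_eq)
  qed
  have int: "S \<inter> T \<in> L" if S: "S \<in> L" and T: "T \<in> L" for S T
  proof -
    have ST: "S \<inter> T \<in> order_ideals V P"
      using L_ideal[OF S] L_ideal[OF T] by (auto simp: order_ideals_def)
    \<comment> \<open>Monotonicity confines the image to the fixed sets \<open>S\<close> and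
      \<open>T\<close>; equal cardinality then makes the inclusion an equality.\<close>
    have "\<phi> (S \<inter> T) \<subseteq> S \<inter> T"
      using mono[OF ST L_ideal[OF S]] mono[OF ST L_ideal[OF T]] L_fix[OF S] L_fix[OF T] by auto
    then show ?thesis using card[OF ST] fin[OF ST] ST L_iff by (simp add: card_subset_eq)
  qed
  have un: "S \<union> T \<in> L" if S: "S \<in> L" and T: "T \<in> L" for S T
  proof -
    have ST: "S \<union> T \<in> order_ideals V P"
      using L_ideal[OF S] L_ideal[OF T] by (auto simp: order_ideals_def)
    \<comment> \<open>Dually, the image must contain the fixed sets \<open>S\<close> and
      \<open>T\<close>.\<close>
    have "S \<union> T \<subseteq> \<phi> (S \<union> T)"
      using mono[OF L_ideal[OF S] ST] mono[OF L_ideal[OF T] ST] L_fix[OF S] L_fix[OF T] by auto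
    then have "S \<union> T = \<phi> (S \<union> T)"
      using card[OF ST] fin[OF map[OF ST]] by (simp add: card_subset_eq)
    then show ?thesis using ST L_iff by simp
  qed
  have "L = order_ideals V Q"
    unfolding Q_def
    by (rule finite_set_lattice_eq_order_ideals)
       (use assms(1) bot top int un L_ideal in \<open>auto simp: order_ideals_def\<close>)
  moreover have "P \<subseteq> Q"
  proof (rule subrelI)
    fix x y assume xy: "(x, y) \<in> P"
    then have "x \<in> V" "y \<in> V" using partial_order_onD(4)[OF assms(2)] by auto
    with xy show "(x, y) \<in> Q" using L_ideal by (auto simp: Q_def order_ideals_def)
  qed
  moreover have "antisym Q"
  proof (rule antisymI, rule ccontr)
    fix x y assume xy: "(x, y) \<in> Q" "(y, x) \<in> Q" "x \<noteq> y"
    obtain \<tau> :: "'a \<Rightarrow> nat" where \<tau>: "bij_betw \<tau> V {0..<card V}"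
      and \<tau>_mono: "\<And>x y. x \<in> V \<Longrightarrow> y \<in> V \<Longrightarrow> (x, y) \<in> P \<Longrightarrow> \<tau> x \<le> \<tau> y"
      using assms(3) unfolding steiner_operation_def by (elim conjE exE) simp
    \<comment> \<open>As \<open>\<tau>\<close> takes the values from 0 to \<open>card V - 1\<close>,
      the strict bound gives \<open>J k\<close> exactly \<open>k\<close> elements for
      \<open>k \<le> card V\<close>. Monotonicity of \<open>\<tau>\<close> makes \<open>J k\<close>
      an ideal.\<close>
    define J where "J k = {v \<in> V. \<tau> v < k}" for k
    have J: "J k \<in> order_ideals V P" for k
      using \<tau>_mono unfolding J_def order_ideals_def by fastforce
    have cardJ: "card (J k) = k" if "k \<le> card V" for k
    proof -
      have "\<tau> ` J k = {0..<k}"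
      proof (intro subset_antisym subsetI)
        fix i assume i: "i \<in> {0..<k}"
        then have "i \<in> \<tau> ` V" using \<tau> that by (simp add: bij_betw_def)
        then show "i \<in> \<tau> ` J k" using i by (auto simp: J_def)
      qed (auto simp: J_def)
      moreover have "inj_on \<tau> (J k)"
        using \<tau> unfolding J_def bij_betw_def by (auto intro: inj_on_subset)
      ultimately show ?thesis by (metis card_atLeastLessThan card_image diff_zero)
    qed
    have "J (card V) = V" using \<tau> by (auto simp: J_def bij_betw_def)
    then have \<phi>JV: "\<phi> (J (card V)) = V" using L_fix[OF top] by simp
    \<comment> \<open>Points related both ways by \<open>Q\<close> lie in the same members of
      \<open>L\<close>, so a separating \<open>\<phi> (J k)\<close> is a contradiction.\<close>
    have "\<exists>k\<le>card V. (x \<in> \<phi> (J k)) \<noteq> (y \<in> \<phi> (J k))"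
    proof (rule full_chain_separates_points[of "card V" "\<lambda>k. \<phi> (J k)" x y])
      fix i j :: nat assume "i \<le> j"
      then show "\<phi> (J i) \<subseteq> \<phi> (J j)" by (intro mono J) (auto simp: J_def)
    next
      show "finite (\<phi> (J (card V)))" using \<phi>JV assms(1) by simp
    next
      fix i assume "i \<le> card V"
      then show "card (\<phi> (J i)) = i" using card[OF J] cardJ by simp
    qed (use xy \<phi>JV in \<open>auto simp: Q_def\<close>)
    moreover have "\<phi> (J k) \<in> L" for k using \<phi>L[OF J] .
    ultimately show False using xy unfolding Q_def by blast
  qed
  moreover have "refl_on V Q" by (auto simp: Q_def refl_on_def)
  moreover have "trans Q" unfolding Q_def by (rule transI) blast
  moreover have "Q \<subseteq> V \<times> V" by (auto simp: Q_def)
  ultimately show "\<exists>Q. partial_order_on V Q \<and> P \<subseteq> Q \<and> stop_range V P \<phi> = order_ideals V Q"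
    unfolding partial_order_on_def preorder_on_def L_def by blast
next
  fix Q R
  assume Q: "partial_order_on V Q \<and> P \<subseteq> Q \<and> stop_range V P \<phi> = order_ideals V Q"
    and R: "partial_order_on V R \<and> P \<subseteq> R \<and> stop_range V P \<phi> = order_ideals V R"
  \<comment> \<open>Both orders are read off from the same family of ideals.\<close>
  have "Q = {(x, y) \<in> V \<times> V. \<forall>T\<in>order_ideals V Q. y \<in> T \<longrightarrow> x \<in> T}"
    using Q by (intro partial_order_eq_ideal_membership) simp
  also have "order_ideals V Q = order_ideals V R" using Q R by simp
  also have "{(x, y) \<in> V \<times> V. \<forall>T\<in>order_ideals V R. y \<in> T \<longrightarrow> x \<in> T} = R"
    using R by (intro partial_order_eq_ideal_membership[symmetric]) simp
  finally show "Q = R" .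
qed

end
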